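(* Let $\mathbb{F}$ be an algebraically closed field with $\mathrm{Char}(\mathbb{F})=5$, and let $i\in\mathbb{F}$ be a fixed element with $i^2=-1$. Then any nontrivial $2$-dimensional Jordan algebra over $\mathbb{F}$ is isomorphic to one and only one of the following algebras, given by their matrices of structure constants (different values of a parameter count as different algebras in the list): $$J_{1,5}=\begin{pmatrix}\frac12&0&0&1\\0&\frac12&\frac12&0\end{pmatrix},\qquad J_{2,5}=\begin{pmatrix}\frac12&0&0&1\\0&-\frac12&\frac12&0\end{pmatrix},$$ $$J_{3,5}(\alpha_1)=\begin{pmatrix}\alpha_1&0&0&0\\0&-1+2\alpha_1&-\alpha_1+1&0\end{pmatrix},\ \text{where }\alpha_1\in\mathbb{F},$$ $$J_{4,5}(\alpha_1)=\begin{pmatrix}\alpha_1&0&0&0\\0&\sqrt{\alpha_1-\alpha_1^2}&-\alpha_1+1&0\end{pmatrix},\ \text{where }\alpha_1\in\mathbb{F},$$ $$J_{5,5}(\alpha_1)=\begin{pmatrix}\alpha_1&0&0&0\\0&-\sqrt{\alpha_1-\alpha_1^2}&-\alpha_1+1&0\end{pmatrix},\ \text{where }\alpha_1\in\mathbb{F},\ \alpha_1\neq0,1,$$ $$J_{6,5}=\begin{pmatrix}\frac13&0&0&0\\0&\frac23&-\frac13&0\end{pmatrix},\qquad J_{7,5}=\begin{pmatrix}\frac12-\frac i2&0&0&0\\0&\frac12+\frac i2&-\frac12+\frac i2&0\end{pmatrix},$$ $$J_{8,5}=\begin{pmatrix}\frac12+\frac i2&0&0&0\\0&\frac12-\frac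 i2&-\frac12-\frac i2&0\end{pmatrix},$$ $$J_{9,5}=\begin{pmatrix}\frac13&0&0&0\\1&\frac23&-\frac13&0\end{pmatrix}=\begin{pmatrix}-\frac12&0&0&0\\1&-1&\frac12&0\end{pmatrix},\qquad J_{10,5}=\begin{pmatrix}0&0&0&0\\1&0&0&0\end{pmatrix}.$$
   Context: An algebra over a field $\mathbb{F}$ is an $\mathbb{F}$-vector space $\mathbb{A}$ with a bilinear multiplication $\cdot$ (not assumed associative, commutative or unital); it is nontrivial if the multiplication is not identically zero. Two algebras are isomorphic if there is an invertible linear map between them preserving the multiplication. An algebra $\mathbb{A}$ is a Jordan algebra if $(\mathbf{u}\cdot\mathbf{v})\cdot\mathbf{u}^2=\mathbf{u}\cdot(\mathbf{v}\cdot\mathbf{u}^2)$ for all $\mathbf{u},\mathbf{v}\in\mathbb{A}$, where $\mathbf{u}^2=\mathbf{u}\cdot\mathbf{u}$; commutativity is NOT assumed. The matrix of structure constants $A=\begin{pmatrix}\alpha_1&\alpha_2&\alpha_3&\alpha_4\\\beta_1&\beta_2&\beta_3&\beta_4\end{pmatrix}$ of a $2$-dimensional algebra with respect to a basis $(e^1,e^2)$ is defined by $e^1\cdot e^1=\alpha_1e^1+\beta_1e^2$, $e^1\cdot e^2=\alpha_2e^1+\beta_2e^2$, $e^2\cdot e^1=\alpha_3e^1+\beta_3e^2$, $e^2\cdot e^2=\alpha_4e^1+\beta_4e^2$. An algebra is identified with its matrix of structure constants. For $a\in\mathbb{F}$, $\sqrt a$ denotes a fixed chosen square root of $a$ in $\mathbb{F}$.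 *)

theory Defs
  imports "HOL-Analysis.Analysis"
begin

text \<open>Algebras over a field: the multiplication is bilinear, but neither associativity,
  commutativity nor a unit is assumed.\<close>

locale nonassoc_algebra = vector_space sc
  for sc :: "'f::field \<Rightarrow> 'v::ab_group_add \<Rightarrow> 'v" +
  fixes mul :: "'v \<Rightarrow> 'v \<Rightarrow> 'v"
  assumes linear_right: "Vector_Spaces.linear sc sc (\<lambda>v. mul u v)"
    and linear_left: "Vector_Spaces.linear sc sc (\<lambda>u. mul u v)"

definition nontrivial_mul :: "('v::ab_group_add \<Rightarrow> 'v \<Rightarrow> 'v) \<Rightarrow> bool" where
  "nontrivial_mul mul \<longleftrightarrow> (\<exists>u v. mul u v \<noteq> 0)"

locale jordan_algebra = nonassoc_algebra sc mul
  for sc :: "'f::field \<Rightarrow> 'v::ab_group_add \<Rightarrow> 'v" and mul +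
  assumes jordan: "mul (mul u v) (mul u u) = mul u (mul v (mul u u))"

definition algebra_isomorphic ::
  "('f::field \<Rightarrow> 'v::ab_group_add \<Rightarrow> 'v) \<Rightarrow> ('v \<Rightarrow> 'v \<Rightarrow> 'v) \<Rightarrow>
   ('f \<Rightarrow> 'w::ab_group_add \<Rightarrow> 'w) \<Rightarrow> ('w \<Rightarrow> 'w \<Rightarrow> 'w) \<Rightarrow> bool" where
  "algebra_isomorphic sc1 mul1 sc2 mul2 \<longleftrightarrow>
     (\<exists>f. Vector_Spaces.linear sc1 sc2 f \<and> bij f \<and>
          (\<forall>u v. f (mul1 u v) = mul2 (f u) (f v)))"

definition is_structure_matrix ::
  "('f::field \<Rightarrow> 'v::ab_group_add \<Rightarrow> 'v) \<Rightarrow> ('v \<Rightarrow> 'v \<Rightarrow> 'v) \<Rightarrow> 'v \<Rightarrow> 'v \<Rightarrow> 'f ^ 4 ^ 2 \<Rightarrow> bool" where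
  "is_structure_matrix sc mul e1 e2 A \<longleftrightarrow>
     e1 \<noteq> e2 \<and> \<not> module.dependent sc {e1, e2} \<and> module.span sc {e1, e2} = UNIV \<and>
     mul e1 e1 = sc (A$1$1) e1 + sc (A$2$1) e2 \<and>
     mul e1 e2 = sc (A$1$2) e1 + sc (A$2$2) e2 \<and>
     mul e2 e1 = sc (A$1$3) e1 + sc (A$2$3) e2 \<and>
     mul e2 e2 = sc (A$1$4) e1 + sc (A$2$4) e2"

lemma vector_4 [simp]:
  "(vector [w, x, y, z] :: 'a::zero ^ 4) $ 1 = w"
  "(vector [w, x, y, z] :: 'a::zero ^ 4) $ 2 = x"
  "(vector [w, x, y, z] :: 'a::zero ^ 4) $ 3 = y"
  "(vector [w, x, y, z] :: 'a::zero ^ 4) $ 4 = z"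
  unfolding vector_def by simp_all

text \<open>The algebra given by a matrix of structure constants is the coordinate space with
  product \<open>u \<cdot> v = A (u \<otimes> v)\<close>; \<open>is_structure_matrix_coord_mul\<close> below says that \<open>A\<close> is indeed
  its matrix of structure constants with respect to the standard basis.\<close>

definition coord_mul :: "'f::field ^ 4 ^ 2 \<Rightarrow> 'f ^ 2 \<Rightarrow> 'f ^ 2 \<Rightarrow> 'f ^ 2" where
  "coord_mul A u v = A *v vector [u$1 * v$1, u$1 * v$2, u$2 * v$1, u$2 * v$2]"

lemma coord_mul_nth:
  "coord_mul A u v $ k =
     A$k$1 * (u$1 * v$1) + A$k$2 * (u$1 * v$2) + A$k$3 * (u$2 * v$1) + A$k$4 * (u$2 * v$2)"
  by (simp add: coord_mul_def matrix_vector_mult_def sum_4)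

lemma nonassoc_algebra_coord_mul: "nonassoc_algebra (*s) (coord_mul A)"
  by unfold_locales (simp_all add: vec_eq_iff coord_mul_nth algebra_simps)

lemma is_structure_matrix_coord_mul:
  fixes A :: "'f::field ^ 4 ^ 2"
  shows "is_structure_matrix (*s) (coord_mul A) (axis 1 1) (axis 2 1) A"
proof -
  have cb: "cart_basis = {axis 1 1, axis 2 1 :: 'f ^ 2}"
    unfolding cart_basis_def by (auto simp: UNIV_2)
  have "axis 1 1 \<noteq> (axis 2 1 :: 'f ^ 2)"
    by (simp add: axis_eq_axis)
  moreover have "vec.independent {axis 1 1, axis 2 1 :: 'f ^ 2}"
    by (metis cb vec.independent_Basis)
  moreover have "vec.span {axis 1 1, axis 2 1 :: 'f ^ 2} = UNIV"
    by (metis cb vec.span_Basis)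
  ultimately show ?thesis
    by (simp add: is_structure_matrix_def vec_eq_iff coord_mul_nth axis_def forall_2)
qed

definition J1 :: "'f::field ^ 4 ^ 2" where
  "J1 = vector [vector [1/2, 0, 0, 1],
                vector [0, 1/2, 1/2, 0]]"

definition J2 :: "'f::field ^ 4 ^ 2" where
  "J2 = vector [vector [1/2, 0, 0, 1],
                vector [0, -(1/2), 1/2, 0]]"

definition J3 :: "'f::field \<Rightarrow> 'f ^ 4 ^ 2" where
  "J3 a = vector [vector [a, 0, 0, 0],
                  vector [0, -1 + 2 * a, -a + 1, 0]]"

text \<open>The parameter \<open>rt\<close> is the chosen square root function of the field.\<close>

definition J4 :: "('f \<Rightarrow> 'f) \<Rightarrow> 'f::field \<Rightarrow> 'f ^ 4 ^ 2" where
  "J4 rt a = vector [vector [a, 0, 0, 0],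
                     vector [0, rt (a - a^2), -a + 1, 0]]"

definition J5 :: "('f \<Rightarrow> 'f) \<Rightarrow> 'f::field \<Rightarrow> 'f ^ 4 ^ 2" where
  "J5 rt a = vector [vector [a, 0, 0, 0],
                     vector [0, - rt (a - a^2), -a + 1, 0]]"

definition J6 :: "'f::field ^ 4 ^ 2" where
  "J6 = vector [vector [1/3, 0, 0, 0],
                vector [0, 2/3, -(1/3), 0]]"

text \<open>The parameter \<open>i\<close> is the chosen square root of \<open>-1\<close>.\<close>

definition J7 :: "'f::field \<Rightarrow> 'f ^ 4 ^ 2" where
  "J7 i = vector [vector [1/2 - i/2, 0, 0, 0],
                  vector [0, 1/2 + i/2, -(1/2) + i/2, 0]]"

definition J8 :: "'f::field \<Rightarrow> 'f ^ 4 ^ 2" where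
  "J8 i = vector [vector [1/2 + i/2, 0, 0, 0],
                  vector [0, 1/2 - i/2, -(1/2) - i/2, 0]]"

definition J9 :: "'f::field ^ 4 ^ 2" where
  "J9 = vector [vector [1/3, 0, 0, 0],
                vector [1, 2/3, -(1/3), 0]]"

definition J10 :: "'f::field ^ 4 ^ 2" where
  "J10 = vector [vector [0, 0, 0, 0],
                 vector [1, 0, 0, 0]]"

text \<open>Algebras are identified with their matrices, so the list is a set of matrices. Different
  parameter values in a family give different matrices. In characteristic 5 the element \<open>i\<close>
  lies in the prime field (it is 2 or 3), and \<open>J6\<close> is literally the same matrix as \<open>J7 i\<close> or
  \<open>J8 i\<close>, as proved below; in a set this repeated entry counts once.\<close>

definition jordan_list :: "('f \<Rightarrow> 'f) \<Rightarrow> 'f::field \<Rightarrow> ('f ^ 4 ^ 2) set" where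
  "jordan_list rt i =
     {J1, J2, J6, J7 i, J8 i, J9, J10} \<union> range J3 \<union> range (J4 rt) \<union> J5 rt ` (- {0, 1})"

lemma J6_eq_J7_or_J8:
  fixes i :: "'f::field"
  assumes "CHAR('f) = 5" and "i^2 = -1"
  shows "J6 = J7 i \<or> J6 = J8 i"
proof -
  have five: "(5::'f) = 0"
    using of_nat_CHAR[where ?'a='f] assms(1) by simp
  have two: "(2::'f) \<noteq> 0" and three: "(3::'f) \<noteq> 0"
    using of_nat_eq_0_iff_char_dvd[where ?'a='f, of 2] of_nat_eq_0_iff_char_dvd[where ?'a='f, of 3] assms(1)
    by auto
  have "(i - 2) * (i + 2) = i^2 + 1 - 5"
    by (simp add: power2_eq_square algebra_simps)
  then have "(i - 2) * (i + 2) = 0"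
    using assms(2) five by simp
  then have "i = 2 \<or> i = -2"
    by (auto simp: eq_neg_iff_add_eq_0)
  moreover have "(6::'f) = 5 + 1"
    by simp
  then have "(6::'f) = 1"
    using five by simp
  then have third: "1/3 = (2::'f)" and half: "1/2 = (3::'f)"
    using nonzero_eq_divide_eq[OF three, of 2 1] nonzero_eq_divide_eq[OF two, of 3 1] by simp_all
  have two_thirds: "2/3 = (4::'f)"
    using arg_cong[OF third, of "\<lambda>x. 2 * x"] by simp
  ultimately show ?thesis
    using two by (auto simp: J6_def J7_def J8_def third half two_thirds)
qed

end

theory Submission
  imports Defs
begin

text \<open>Choose coordinates, so that a two-dimensional algebra becomes a table of eight structure constants,
and write \<open>L\<^sub>u\<close>, \<open>R\<^sub>w\<close> for left and right multiplication. The Jordan identity says precisely that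
\<open>L\<^sub>u\<close> commutes with \<open>R\<^sub>w\<close> for \<open>w = u\<^sup>2\<close>, and every argument about it below reads off coefficients of this
commutation relation of \<open>2 \<times> 2\<close> matrices (\<open>jordan_commute\<close>).

Over an algebraically closed field some nonzero \<open>u\<close> satisfies \<open>u\<^sup>2 = c u\<close>, since the condition is a
cubic equation. Suppose \<open>c\<close> can be chosen nonzero; rescaling gives an idempotent \<open>e\<close>. Now \<open>L\<^sub>e\<close>
and \<open>R\<^sub>e\<close> commute and have the common eigenvector \<open>e\<close>. Outside characteristics 2 and 3 the Jordan
identity rules out nontrivial Jordan blocks with the double eigenvalue 1, and a second common
eigenvector exists (\<open>idempotent_peirce\<close>). The possible eigenvalues are so restricted
(\<open>peirce_eigenvalues\<close>) that the algebra is \<open>J1\<close>, \<open>J2\<close>, or has a one-dimensional ideal with zero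
multiplication. If no \<open>c\<close> can be chosen nonzero, a vector with square zero is available, and the same
relation again produces an ideal of this kind (\<open>nil_normal_form\<close>).

An algebra with such an ideal, spanned by the second basis vector, has only four structure constants:
\<open>e1 e1 = a e1 + d e2\<close>, \<open>e1 e2 = b e2\<close>, \<open>e2 e1 = c e2\<close>. The Jordan identity becomes
\<open>(b\<^sup>2 - a c) (a - b - c) = 0\<close> and \<open>d (b\<^sup>2 - a c) = 0\<close>. If \<open>a \<noteq> b + c\<close>, replacing \<open>e1\<close> by \<open>e1 + t e2\<close>
removes \<open>d\<close>. If \<open>a = b + c\<close> and \<open>d \<noteq> 0\<close>, the second equation reads \<open>b\<^sup>2 - b c - c\<^sup>2 = 0\<close>; its
discriminant is 5 times a square, so in characteristic 5 it is the single condition \<open>b = - 2 c\<close>, which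
accounts for \<open>J9\<close> and \<open>J10\<close>. The remaining algebras are given by \<open>(a, b, c)\<close> up to a common
factor, on the union of the conic \<open>b\<^sup>2 = a c\<close> and the line \<open>a = b + c\<close>. Scaling to \<open>a + c = 1\<close> gives
\<open>J3\<close> on the line and \<open>J4\<close>, \<open>J5\<close> on the conic; the points with \<open>a + c = 0\<close> are \<open>J6\<close>, \<open>J7\<close> and
\<open>J8\<close>.

For uniqueness, the second basis vector spans a line that any isomorphism must preserve, so an
isomorphism between two algebras of this shape is triangular and multiplies \<open>(a, b, c)\<close> by a nonzero
factor (\<open>ideal_table_iso_triangular\<close>). All listed tables of this shape obey one normalisation of
\<open>(a, b, c, d)\<close>, under which isomorphic tables are equal (\<open>normalized_unique\<close>). This compares
matrices, so coincidences between entries of the list do no harm. Finally \<open>J1\<close> and \<open>J2\<close> have no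
one-dimensional square-zero ideal, and of the two only \<open>J1\<close> is commutative.\<close>

section \<open>Isomorphism of algebras\<close>

lemma algebra_isomorphic_sym:
  assumes "algebra_isomorphic sc1 mul1 sc2 mul2"
  shows "algebra_isomorphic sc2 mul2 sc1 mul1"
proof -
  obtain f where f: "Vector_Spaces.linear sc1 sc2 f" "bij f"
    and hom: "\<And>u v. f (mul1 u v) = mul2 (f u) (f v)"
    using assms by (auto simp: algebra_isomorphic_def)
  interpret f: Vector_Spaces.linear sc1 sc2 f by fact
  have inv_eq: "inv f y = x \<longleftrightarrow> y = f x" for x y
    using f(2) by (metis bij_inv_eq_iff)
  have f_inv: "f (inv f y) = y" for y
    using inv_eq by metis
  have "Vector_Spaces.linear sc2 sc1 (inv f)"
    by unfold_locales (simp_all add: inv_eq f.add f.scale f_inv)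
  moreover have "inv f (mul2 u v) = mul1 (inv f u) (inv f v)" for u v
    by (simp add: inv_eq hom f_inv)
  ultimately show ?thesis
    using bij_imp_bij_inv[OF f(2)] by (auto simp: algebra_isomorphic_def)
qed

lemma algebra_isomorphic_trans:
  assumes "algebra_isomorphic sc1 mul1 sc2 mul2" "algebra_isomorphic sc2 mul2 sc3 mul3"
  shows "algebra_isomorphic sc1 mul1 sc3 mul3"
proof -
  obtain f g where "Vector_Spaces.linear sc1 sc2 f" "bij f"
    and "\<And>u v. f (mul1 u v) = mul2 (f u) (f v)"
    and "Vector_Spaces.linear sc2 sc3 g" "bij g"
    and "\<And>u v. g (mul2 u v) = mul3 (g u) (g v)"
    using assms by (auto simp: algebra_isomorphic_def)
  then show ?thesis
    using bij_comp[of f g] Vector_Spaces.linear_compose[of sc1 sc2 f sc3 g]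
    by (auto simp: algebra_isomorphic_def intro!: exI[of _ "g \<circ> f"])
qed

lemma jordan_algebra_transfer:
  assumes "algebra_isomorphic sc mul (*s) (coord_mul A)" "jordan_algebra sc mul"
  shows "jordan_algebra (*s) (coord_mul A)"
proof -
  obtain f where f: "bij f" "\<And>u v. f (mul u v) = coord_mul A (f u) (f v)"
    using assms(1) by (auto simp: algebra_isomorphic_def)
  interpret jordan_algebra sc mul by fact
  have "coord_mul A (coord_mul A u v) (coord_mul A u u) =
        coord_mul A u (coord_mul A v (coord_mul A u u))" for u v
    using f(2) jordan[of "inv f u" "inv f v"] bij_inv_eq_iff[OF f(1)] by metis
  then show ?thesis
    using nonassoc_algebra_coord_mul[of A]
    by (simp add: jordan_algebra_def jordan_algebra_axioms_def)
qed

text \<open>The structure constants are found by pulling the products of basis vectors back along the linear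
  bijection \<open>\<phi>\<close> from the coordinate plane; bilinearity then makes \<open>\<phi>\<close> multiplicative.\<close>

lemma exists_coordinates:
  assumes "nonassoc_algebra sc mul" "vector_space.dim sc (UNIV :: 'v::ab_group_add set) = 2"
  shows "\<exists>A. algebra_isomorphic (sc :: 'f::field \<Rightarrow> 'v \<Rightarrow> 'v) mul (*s) (coord_mul A)"
proof -
  interpret nonassoc_algebra sc mul by fact
  interpret R: Vector_Spaces.linear sc sc "\<lambda>v. mul u v" for u by (rule linear_right)
  interpret L: Vector_Spaces.linear sc sc "\<lambda>u. mul u v" for v by (rule linear_left)
  obtain S where S: "independent S" "UNIV \<subseteq> span S" "card S = 2"
    using basis_exists[of UNIV] assms(2) by metis
  then obtain e1 e2 where e: "S = {e1, e2}" "e1 \<noteq> e2"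
    by (meson card_2_iff)
  define \<phi> where "\<phi> = (\<lambda>v :: 'f ^ 2. sc (v$1) e1 + sc (v$2) e2)"
  have lin: "Vector_Spaces.linear (*s) sc \<phi>"
    by unfold_locales (simp_all add: \<phi>_def algebra_simps)
  interpret \<phi>: Vector_Spaces.linear "(*s)" sc \<phi> by (fact lin)
  have e2: "e2 \<noteq> 0" and e1: "e1 \<notin> span {e2}"
    using S(1) e dependent_zero[of S] by (auto simp: independent_insert)
  have "v = 0" if "\<phi> v = 0" for v
  proof -
    have eq: "sc (v$1) e1 = sc (- (v$2)) e2"
      using that by (simp add: \<phi>_def eq_neg_iff_add_eq_0)
    have "v$1 = 0"
    proof (rule ccontr)
      assume "v$1 \<noteq> 0"
      then have "e1 = sc (inverse (v$1)) (sc (v$1) e1)"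
        by simp
      then have "e1 \<in> span {e2}"
        unfolding eq by (metis span_base span_scale singletonI)
      then show False
        using e1 by contradiction
    qed
    then show "v = 0"
      using eq e2 by (simp add: vec_eq_iff forall_2)
  qed
  then have "inj \<phi>"
    by (metis \<phi>.inj_iff_eq_0)
  moreover have "\<exists>v. w = \<phi> v" for w
  proof -
    have "w \<in> span {e1, e2}"
      using S(2) e(1) by blast
    then obtain x y where "w - sc x e1 - sc y e2 = 0"
      unfolding span_breakdown_eq span_empty by blast
    then have "w = \<phi> (vector [x, y])"
      by (simp add: \<phi>_def algebra_simps)
    then show ?thesis ..
  qed
  ultimately have bij: "bij \<phi>"
    by (auto simp: bij_def surj_def)
  have "\<exists>v. \<phi> v = w" for w
    using bij by (metis bij_pointE)
  then obtain c where c: "\<And>w. \<phi> (c w) = w"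
    by metis
  define A :: "'f ^ 4 ^ 2" where
    "A = (\<chi> k. vector [c (mul e1 e1) $ k, c (mul e1 e2) $ k, c (mul e2 e1) $ k, c (mul e2 e2) $ k])"
  have "\<phi> (coord_mul A u v) = mul (\<phi> u) (\<phi> v)" for u v
  proof -
    have "coord_mul A u v = (u$1 * v$1) *s c (mul e1 e1) + (u$1 * v$2) *s c (mul e1 e2) +
       (u$2 * v$1) *s c (mul e2 e1) + (u$2 * v$2) *s c (mul e2 e2)"
      by (simp add: vec_eq_iff coord_mul_nth A_def algebra_simps)
    then have "\<phi> (coord_mul A u v) = sc (u$1 * v$1) (mul e1 e1) + sc (u$1 * v$2) (mul e1 e2) +
       sc (u$2 * v$1) (mul e2 e1) + sc (u$2 * v$2) (mul e2 e2)"
      by (simp add: \<phi>.add \<phi>.scale c)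
    also have "\<dots> = mul (\<phi> u) (\<phi> v)"
      by (simp add: \<phi>_def L.add R.add L.scale R.scale scale_right_distrib mult.commute)
    finally show ?thesis .
  qed
  then have "algebra_isomorphic (*s) (coord_mul A) sc mul"
    using lin bij by (auto simp: algebra_isomorphic_def)
  then show ?thesis
    using algebra_isomorphic_sym by blast
qed

section \<open>Tables of structure constants and changes of basis\<close>

abbreviation isomorphic_tables :: "'f::field ^ 4 ^ 2 \<Rightarrow> 'f ^ 4 ^ 2 \<Rightarrow> bool" (infix "\<simeq>" 50)
  where "A \<simeq> B \<equiv> algebra_isomorphic (*s) (coord_mul A) (*s) (coord_mul B)"

abbreviation table ::
  "'f::field \<Rightarrow> 'f \<Rightarrow> 'f \<Rightarrow> 'f \<Rightarrow> 'f \<Rightarrow> 'f \<Rightarrow> 'f \<Rightarrow> 'f \<Rightarrow> 'f ^ 4 ^ 2" where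
  "table a1 a2 a3 a4 b1 b2 b3 b4 \<equiv> vector [vector [a1, a2, a3, a4], vector [b1, b2, b3, b4]]"

text \<open>Here \<open>f1\<close> and \<open>f2\<close> are the new basis vectors, written in the coordinates of \<open>A\<close>, and \<open>B\<close> is the table
  of the same algebra in the new basis. The first condition is the linear independence of the pair.\<close>

definition basis_change :: "'f::field ^ 4 ^ 2 \<Rightarrow> 'f ^ 4 ^ 2 \<Rightarrow> 'f ^ 2 \<Rightarrow> 'f ^ 2 \<Rightarrow> bool" where
  "basis_change A B f1 f2 \<longleftrightarrow>
     f1$1 * f2$2 - f1$2 * f2$1 \<noteq> 0 \<and>
     coord_mul A f1 f1 = B$1$1 *s f1 + B$2$1 *s f2 \<and>
     coord_mul A f1 f2 = B$1$2 *s f1 + B$2$2 *s f2 \<and>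
     coord_mul A f2 f1 = B$1$3 *s f1 + B$2$3 *s f2 \<and>
     coord_mul A f2 f2 = B$1$4 *s f1 + B$2$4 *s f2"

lemma basis_change_table:
  "basis_change (table a1 a2 a3 a4 b1 b2 b3 b4) (table a1' a2' a3' a4' b1' b2' b3' b4')
     (vector [p, q]) (vector [r, s]) \<longleftrightarrow>
   p * s - q * r \<noteq> 0 \<and>
   a1 * (p * p) + a2 * (p * q) + a3 * (q * p) + a4 * (q * q) = a1' * p + b1' * r \<and>
   b1 * (p * p) + b2 * (p * q) + b3 * (q * p) + b4 * (q * q) = a1' * q + b1' * s \<and>
   a1 * (p * r) + a2 * (p * s) + a3 * (q * r) + a4 * (q * s) = a2' * p + b2' * r \<and>
   b1 * (p * r) + b2 * (p * s) + b3 * (q * r) + b4 * (q * s) = a2' * q + b2' * s \<and>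
   a1 * (r * p) + a2 * (r * q) + a3 * (s * p) + a4 * (s * q) = a3' * p + b3' * r \<and>
   b1 * (r * p) + b2 * (r * q) + b3 * (s * p) + b4 * (s * q) = a3' * q + b3' * s \<and>
   a1 * (r * r) + a2 * (r * s) + a3 * (s * r) + a4 * (s * s) = a4' * p + b4' * r \<and>
   b1 * (r * r) + b2 * (r * s) + b3 * (s * r) + b4 * (s * s) = a4' * q + b4' * s"
  by (simp add: basis_change_def vec_eq_iff forall_2 coord_mul_nth)

lemma independent_pair_coords:
  fixes f1 f2 w :: "'f::field ^ 2"
  assumes det: "f1$1 * f2$2 - f1$2 * f2$1 \<noteq> 0"
  shows "w = x *s f1 + y *s f2 \<longleftrightarrow>
    x = (w$1 * f2$2 - w$2 * f2$1) / (f1$1 * f2$2 - f1$2 * f2$1) \<and>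
    y = (w$2 * f1$1 - w$1 * f1$2) / (f1$1 * f2$2 - f1$2 * f2$1)"
    (is "?L \<longleftrightarrow> ?R")
proof -
  define p q r s u v where "p = f1$1" and "q = f1$2" and "r = f2$1" and "s = f2$2"
    and "u = w$1" and "v = w$2"
  have det': "p * s - q * r \<noteq> 0"
    using det by (simp add: p_def q_def r_def s_def)
  have "?L \<longleftrightarrow> u = x * p + y * r \<and> v = x * q + y * s"
    by (simp add: vec_eq_iff forall_2 p_def q_def r_def s_def u_def v_def)
  also have "\<dots> \<longleftrightarrow> x * (p * s - q * r) = u * s - v * r \<and> y * (p * s - q * r) = v * p - u * q"
    (is "?M \<longleftrightarrow> ?N")
  proof
    assume ?M
    then show ?N
      by (simp add: algebra_simps)
  next
    assume N: ?N
    have "(p * s - q * r) * u = (u * s - v * r) * p + (v * p - u * q) * r"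
      "(p * s - q * r) * v = (u * s - v * r) * q + (v * p - u * q) * s"
      by (simp_all add: algebra_simps)
    then have "(p * s - q * r) * u = (p * s - q * r) * (x * p + y * r)"
      "(p * s - q * r) * v = (p * s - q * r) * (x * q + y * s)"
      unfolding N[THEN conjunct1, symmetric] N[THEN conjunct2, symmetric]
      by (simp_all add: algebra_simps)
    then show ?M
      using det' by simp
  qed
  also have "\<dots> \<longleftrightarrow> x = (u * s - v * r) / (p * s - q * r) \<and> y = (v * p - u * q) / (p * s - q * r)"
    using det' by (simp add: nonzero_eq_divide_eq)
  finally show ?thesis
    by (simp add: p_def q_def r_def s_def u_def v_def)
qed

text \<open>An isomorphism of \<open>B\<close> with \<open>A\<close> is determined by the images of the standard basis vectors, which
  play the role of \<open>f1\<close> and \<open>f2\<close>.\<close>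

lemma isomorphic_tables_iff: "A \<simeq> B \<longleftrightarrow> (\<exists>f1 f2. basis_change A B f1 f2)"
proof
  assume "A \<simeq> B"
  then obtain f where lin: "Vector_Spaces.linear (*s) (*s) f" and bij: "bij f"
    and hom: "\<And>u v. f (coord_mul B u v) = coord_mul A (f u) (f v)"
    using algebra_isomorphic_sym[of "(*s)" "coord_mul A"] unfolding algebra_isomorphic_def by blast
  interpret f: Vector_Spaces.linear "(*s)" "(*s)" f by fact
  define e1 e2 :: "'a ^ 2" where "e1 = vector [1, 0]" and "e2 = vector [0, 1]"
  have prod: "coord_mul B e1 e1 = B$1$1 *s e1 + B$2$1 *s e2"
    "coord_mul B e1 e2 = B$1$2 *s e1 + B$2$2 *s e2"
    "coord_mul B e2 e1 = B$1$3 *s e1 + B$2$3 *s e2"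
    "coord_mul B e2 e2 = B$1$4 *s e1 + B$2$4 *s e2"
    by (simp_all add: e1_def e2_def vec_eq_iff forall_2 coord_mul_nth)
  have "f e1 $ 1 * f e2 $ 2 - f e1 $ 2 * f e2 $ 1 \<noteq> 0"
  proof
    assume det: "f e1 $ 1 * f e2 $ 2 - f e1 $ 2 * f e2 $ 1 = 0"
    have inj: "x = 0 \<and> y = 0" if "x *s f e1 + y *s f e2 = 0" for x y
    proof -
      have "f (x *s e1 + y *s e2) = f 0"
        using that by (simp only: f.add f.scale f.zero)
      then have "x *s e1 + y *s e2 = 0"
        using bij by (metis bij_is_inj injD)
      then show ?thesis
        by (simp add: e1_def e2_def vec_eq_iff forall_2)
    qed
    have "f e2 $ 2 *s f e1 + (- (f e1 $ 2)) *s f e2 = 0"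
      "(- (f e2 $ 1)) *s f e1 + f e1 $ 1 *s f e2 = 0"
      using det by (simp_all add: vec_eq_iff forall_2 algebra_simps)
    from this[THEN inj] have "f e1 = 0"
      by (simp add: vec_eq_iff forall_2)
    then show False
      using inj[of 1 0] by simp
  qed
  then have "basis_change A B (f e1) (f e2)"
    unfolding basis_change_def by (simp only: prod f.add f.scale flip: hom) simp
  then show "\<exists>f1 f2. basis_change A B f1 f2"
    by blast
next
  assume "\<exists>f1 f2. basis_change A B f1 f2"
  then obtain f1 f2 where chg: "basis_change A B f1 f2"
    by blast
  have det: "f1$1 * f2$2 - f1$2 * f2$1 \<noteq> 0"
    using chg by (simp add: basis_change_def)
  define f where "f = (\<lambda>v :: 'a ^ 2. v$1 *s f1 + v$2 *s f2)"
  have "Vector_Spaces.linear (*s) (*s) f"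
    by unfold_locales (simp_all add: f_def vec_eq_iff forall_2 algebra_simps)
  moreover have "\<exists>!v. w = f v" for w
  proof
    show "w = f (vector [(w$1 * f2$2 - w$2 * f2$1) / (f1$1 * f2$2 - f1$2 * f2$1),
                         (w$2 * f1$1 - w$1 * f1$2) / (f1$1 * f2$2 - f1$2 * f2$1)])"
      unfolding f_def independent_pair_coords[OF det] by simp
    show "v = vector [(w$1 * f2$2 - w$2 * f2$1) / (f1$1 * f2$2 - f1$2 * f2$1),
                      (w$2 * f1$1 - w$1 * f1$2) / (f1$1 * f2$2 - f1$2 * f2$1)]" if "w = f v" for v
      using that unfolding f_def independent_pair_coords[OF det]
      by (simp add: vec_eq_iff forall_2)
  qed
  then have "bij f"
    by (metis bijI')
  moreover have "f (coord_mul B u v) = coord_mul A (f u) (f v)" for u v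
  proof -
    have "coord_mul A (f u) (f v) =
        (u$1 * v$1) *s coord_mul A f1 f1 + (u$1 * v$2) *s coord_mul A f1 f2 +
        (u$2 * v$1) *s coord_mul A f2 f1 + (u$2 * v$2) *s coord_mul A f2 f2"
      by (simp add: vec_eq_iff coord_mul_nth f_def algebra_simps)
    also have "\<dots> = f (coord_mul B u v)"
      using chg by (simp add: basis_change_def f_def coord_mul_nth vec_eq_iff algebra_simps)
    finally show ?thesis ..
  qed
  ultimately have "B \<simeq> A"
    by (auto simp: algebra_isomorphic_def)
  then show "A \<simeq> B"
    by (rule algebra_isomorphic_sym)
qed

lemma isomorphic_tablesI:
  assumes "basis_change A B (vector [p, q]) (vector [r, s])"
  shows "A \<simeq> B"
  using assms isomorphic_tables_iff by blast

lemma isomorphic_tables_refl: "A \<simeq> A"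
  by (rule isomorphic_tablesI[of _ _ 1 0 0 1])
     (simp add: basis_change_def vec_eq_iff forall_2 coord_mul_nth)

lemma isomorphic_tablesE:
  assumes "A \<simeq> B"
  obtains p q r s where "basis_change A B (vector [p, q]) (vector [r, s])"
proof -
  obtain f1 f2 where "basis_change A B f1 f2"
    using assms isomorphic_tables_iff by blast
  moreover have "f1 = vector [f1$1, f1$2]" "f2 = vector [f2$1, f2$2]"
    by (simp_all add: vec_eq_iff forall_2)
  ultimately show ?thesis
    using that by metis
qed

text \<open>A vector whose square is a multiple of itself can serve as the first basis vector: any completion
  to a basis will do, since only the first column of the table is prescribed.\<close>

lemma eigenvector_table:
  assumes "coord_mul A (vector [p, q]) (vector [p, q]) = c *s vector [p, q]" "p \<noteq> 0 \<or> q \<noteq> 0"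
  shows "\<exists>a2 a3 a4 b2 b3 b4. A \<simeq> table c a2 a3 a4 0 b2 b3 b4"
proof -
  define f1 where "f1 = (vector [p, q] :: 'a ^ 2)"
  have "\<exists>r s. p * s - q * r \<noteq> 0"
    using assms(2) by (metis diff_0_right diff_0 mult.right_neutral mult_zero_right neg_equal_0_iff_equal)
  then obtain r s where det: "p * s - q * r \<noteq> 0"
    by blast
  define f2 where "f2 = (vector [r, s] :: 'a ^ 2)"
  have "\<exists>x y. w = x *s f1 + y *s f2" for w
    using det unfolding f1_def f2_def by (subst independent_pair_coords) auto
  then obtain a2 b2 a3 b3 a4 b4 where
    "coord_mul A f1 f2 = a2 *s f1 + b2 *s f2" "coord_mul A f2 f1 = a3 *s f1 + b3 *s f2"
    "coord_mul A f2 f2 = a4 *s f1 + b4 *s f2"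
    by meson
  then have "basis_change A (table c a2 a3 a4 0 b2 b3 b4) f1 f2"
    using assms(1) det by (simp add: basis_change_def f1_def f2_def)
  then show ?thesis
    using isomorphic_tables_iff by blast
qed

section \<open>The Jordan identity in coordinates\<close>

abbreviation jordan_table :: "'f::field ^ 4 ^ 2 \<Rightarrow> bool" where
  "jordan_table A \<equiv> jordan_algebra (*s) (coord_mul A)"

text \<open>For \<open>u = (x, y)\<close> the \<open>l\<close>s are the entries of the matrix of left multiplication by \<open>u\<close>, the pair
  \<open>(z, t)\<close> is \<open>u\<^sup>2\<close>, and the \<open>r\<close>s are the entries of the matrix of right multiplication by \<open>u\<^sup>2\<close>.
  The Jordan identity for all \<open>v\<close> says that the two matrices commute, and the three equations are
  the entries of their commutator.\<close>

lemma jordan_commute: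
  assumes J: "jordan_table (table a1 a2 a3 a4 b1 b2 b3 b4)"
    and L: "l11 = x * a1 + y * a3" "l12 = x * a2 + y * a4"
      "l21 = x * b1 + y * b3" "l22 = x * b2 + y * b4"
    and sq: "z = x * l11 + y * l12" "t = x * l21 + y * l22"
    and R: "r11 = z * a1 + t * a2" "r12 = z * a3 + t * a4"
      "r21 = z * b1 + t * b2" "r22 = z * b3 + t * b4"
  shows "l12 * r21 = l21 * r12"
    and "l12 * (r11 - r22) = r12 * (l11 - l22)"
    and "l21 * (r11 - r22) = r21 * (l11 - l22)"
proof -
  define A where "A = table a1 a2 a3 a4 b1 b2 b3 b4"
  define u where "u = (vector [x, y] :: 'a ^ 2)"
  have square: "coord_mul A u u = vector [z, t]"
    unfolding sq L by (simp add: A_def u_def vec_eq_iff forall_2 coord_mul_nth algebra_simps)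
  have left: "coord_mul A u v = vector [l11 * v$1 + l12 * v$2, l21 * v$1 + l22 * v$2]" for v
    unfolding L by (simp add: A_def u_def vec_eq_iff forall_2 coord_mul_nth algebra_simps)
  have right: "coord_mul A v (vector [z, t]) = vector [r11 * v$1 + r12 * v$2, r21 * v$1 + r22 * v$2]" for v
    unfolding R by (simp add: A_def vec_eq_iff forall_2 coord_mul_nth algebra_simps)
  interpret jordan_algebra "(*s)" "coord_mul A"
    using J by (simp add: A_def)
  have "coord_mul A (coord_mul A u v) (vector [z, t]) = coord_mul A u (coord_mul A v (vector [z, t]))" for v
    using jordan[of u v] by (simp add: square)
  from this[of "vector [1, 0]"] this[of "vector [0, 1]"]
  show "l12 * r21 = l21 * r12" "l12 * (r11 - r22) = r12 * (l11 - l22)"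
    "l21 * (r11 - r22) = r21 * (l11 - l22)"
    unfolding left right by (simp_all add: vec_eq_iff forall_2 algebra_simps)
qed

lemmas jordan_commute_at = jordan_commute[OF _ refl refl refl refl refl refl refl refl refl refl]

text \<open>Inserting \<open>u = e1 + y e2\<close> or \<open>u = y e1 + e2\<close> into the commutation relation and cancelling a factor
  \<open>y\<close> gives quadratic equations valid for all \<open>y \<noteq> 0\<close>. Their coefficients are determined by the
  values at \<open>1\<close>, \<open>-1\<close> and \<open>2\<close>, which are distinct outside characteristics 2 and 3.\<close>

lemma quadratic_zero:
  fixes c0 c1 c2 :: "'f::field"
  assumes "(2::'f) \<noteq> 0" "(3::'f) \<noteq> 0"
    and zero: "\<And>y. y \<noteq> 0 \<Longrightarrow> c0 + c1 * y + c2 * y^2 = 0"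
  shows "c0 = 0" "c1 = 0" "c2 = 0"
proof -
  have 1: "c0 + c1 + c2 = 0" and 2: "c0 - c1 + c2 = 0" and 3: "c0 + 2 * c1 + 4 * c2 = 0"
    using zero[of 1] zero[of "-1"] zero[of 2] assms(1) by (simp_all add: algebra_simps)
  have "2 * c1 = (c0 + c1 + c2) - (c0 - c1 + c2)"
    by (simp add: algebra_simps)
  then show c1: "c1 = 0"
    using 1 2 assms(1) by simp
  have "3 * c2 = (c0 + 2 * c1 + 4 * c2) - (c0 + c1 + c2) - c1"
    by (simp add: algebra_simps)
  also have "\<dots> = 0"
    by (simp only: 1 3) (simp add: c1)
  finally show "c2 = 0"
    using assms(2) by simp
  then show "c0 = 0"
    using 1 c1 by simp
qed

section \<open>Algebras with an idempotent\<close>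

text \<open>The first basis vector is an idempotent \<open>e\<close>, and the second one is replaced by \<open>e2 + t e\<close>.\<close>

lemma shear_idempotent:
  "table 1 p r m 0 q s n \<simeq>
   table 1 (p + t * (1 - q)) (r + t * (1 - s)) (m + t * (p + r) + t * t - t * (n + t * (q + s)))
     0 q s (n + t * (q + s))"
  by (rule isomorphic_tablesI[of _ _ 1 0 t 1], unfold basis_change_table)
     (simp add: algebra_simps)

text \<open>At \<open>u = e\<close> the commutation relation says that \<open>L\<^sub>e\<close> and \<open>R\<^sub>e\<close> commute. If one of them has an eigenvalue
  other than 1, its second eigenvector is an eigenvector of the other as well. If both have the double
  eigenvalue 1, they could still be nontrivial Jordan blocks; the identity at \<open>u = e + y e2\<close> excludes
  this because it forces \<open>r = 2 p\<close> and \<open>6 p\<^sup>2 = 0\<close>.\<close>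

lemma idempotent_peirce:
  fixes p r m q s n :: "'f::field"
  assumes char: "(2::'f) \<noteq> 0" "(3::'f) \<noteq> 0" and J: "jordan_table (table 1 p r m 0 q s n)"
  shows "\<exists>m' n'. table 1 p r m 0 q s n \<simeq> table 1 0 0 m' 0 q s n'"
proof -
  have comm: "p * (1 - s) = r * (1 - q)"
    using jordan_commute_at(2)[OF J, of 1 0] by simp
  show ?thesis
  proof (cases "q = 1 \<and> s = 1")
    case True
    \<comment> \<open>Completing the square: the shear by \<open>- n / 2\<close> makes the square of the second basis vector a multiple of \<open>e\<close>.\<close>
    define m' where "m' = m + (- n / 2) * (p + r) + (- n / 2) * (- n / 2)"
    have iso: "table 1 p r m 0 q s n \<simeq> table 1 p r m' 0 1 1 0"
      using shear_idempotent[of p r m q s n "- n / 2"] char True by (simp add: m'_def)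
    have J': "jordan_table (table 1 p r m' 0 1 1 0)"
      by (rule jordan_algebra_transfer[OF iso J])
    have "(r - 2 * p) + (p + r) * r * y + (m' * r) * y^2 = 0" if "y \<noteq> 0" for y
    proof -
      have "y * ((r - 2 * p) + (p + r) * r * y + (m' * r) * y^2) = 0"
        using jordan_commute_at(1)[OF J', of 1 y]
        by (simp add: algebra_simps power2_eq_square)
      then show ?thesis
        using that by simp
    qed
    from quadratic_zero[OF char this] have "r = 2 * p" "(p + r) * r = 0"
      by simp_all
    then have "2 * 3 * (p * p) = 0"
      by (simp add: algebra_simps)
    then have "p = 0"
      using char by (metis mult_eq_0_iff)
    then show ?thesis
      using iso True \<open>r = 2 * p\<close> by auto
  next
    case False
    then obtain t where "p + t * (1 - q) = 0" "r + t * (1 - s) = 0"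
    proof (cases "q = 1")
      case True
      with False have "s \<noteq> 1" by simp
      then show ?thesis
        using that[of "r / (s - 1)"] comm True by (simp add: field_simps)
    next
      case False
      then have q: "1 - q \<noteq> 0" by simp
      then have "r = p * (1 - s) / (1 - q)"
        using comm by (simp add: nonzero_eq_divide_eq)
      then show ?thesis
        using that[of "- p / (1 - q)"] q by simp
    qed
    then show ?thesis
      using shear_idempotent[of p r m q s n t] by auto
  qed
qed

text \<open>The four alternatives are, in this order: a square-zero ideal, a unital algebra, the algebra \<open>J2\<close> up
  to scaling (if \<open>m \<noteq> 0\<close>), and a direct product of the line of \<open>e\<close> with another line.\<close>

lemma peirce_eigenvalues:
  fixes m q s n :: "'f::field"
  assumes char: "(2::'f) \<noteq> 0" "(3::'f) \<noteq> 0" and J: "jordan_table (table 1 0 0 m 0 q s n)"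
  shows "m = 0 \<and> n = 0 \<or> q = 1 \<and> s = 1 \<or> q = -1 \<and> s = 1 \<and> n = 0 \<or> m = 0 \<and> q = 0 \<and> s = 0"
proof (cases "m = 0")
  case False
  have "((1 - s) - (q + s) * (1 - q)) + (- (n * (1 - q))) * y + (m * (1 - s)) * y^2 = 0"
    if "y \<noteq> 0" for y
  proof -
    have "m * y * (((1 - s) - (q + s) * (1 - q)) + (- (n * (1 - q))) * y + (m * (1 - s)) * y^2) = 0"
      using jordan_commute_at(2)[OF J, of 1 y]
      by (simp add: algebra_simps power2_eq_square)
    then show ?thesis
      using that False by simp
  qed
  note zero = quadratic_zero[OF char this]
  have "s = 1"
    using zero(3) False by simp
  then have "(q + 1) * (1 - q) = 0"
    using zero(1) by simp
  then show ?thesis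
    using zero(2) \<open>s = 1\<close> by (auto simp: eq_neg_iff_add_eq_0)
next
  case True
  show ?thesis
  proof (cases "n = 0")
    case False
    have "(s * (1 - s) - (q + s) * q * (1 - q)) +
       n * (- s * (q + s) - q * (1 - q) + q * (q + s)) * y + (n^2 * (q - s)) * y^2 = 0"
      if "y \<noteq> 0" for y
    proof -
      have "y * ((s * (1 - s) - (q + s) * q * (1 - q)) +
         n * (- s * (q + s) - q * (1 - q) + q * (q + s)) * y + (n^2 * (q - s)) * y^2) = 0"
        using jordan_commute_at(3)[OF J, of 1 y] True
        by (simp add: algebra_simps power2_eq_square)
      then show ?thesis
        using that by simp
    qed
    from quadratic_zero[OF char this]
    have "- s * (q + s) - q * (1 - q) + q * (q + s) = 0" "s = q"
      using False by simp_all
    then have "q * (1 - q) = 0"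
      by simp
    then show ?thesis
      using True \<open>s = q\<close> by auto
  qed (use True in simp)
qed

text \<open>The second basis vector spans an ideal on which the multiplication vanishes.\<close>

definition ideal_table :: "'f::field \<Rightarrow> 'f \<Rightarrow> 'f \<Rightarrow> 'f \<Rightarrow> 'f ^ 4 ^ 2" where
  "ideal_table a b c d = table a 0 0 0 d b c 0"

definition normal_form :: "'f::field ^ 4 ^ 2 \<Rightarrow> bool" where
  "normal_form B \<longleftrightarrow> B = J1 \<or> B = J2 \<or> (\<exists>a b c d. B = ideal_table a b c d)"

lemma normal_form_ideal: "normal_form (table a 0 0 0 d b c 0)"
  unfolding normal_form_def ideal_table_def by blast

lemma alg_closed_sqrt: "\<exists>x :: 'f::alg_closed_field. x^2 = y"
  using nth_root_exists[of 2 y] by auto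

text \<open>Halving \<open>e1\<close> halves its eigenvalues, and \<open>e2\<close> is scaled by \<open>x\<close> with \<open>x\<^sup>2 = 1 / (2 m)\<close> so that
  its square is the new \<open>e1\<close>.\<close>

lemma rescale_idempotent:
  fixes m q s :: "'f::alg_closed_field"
  assumes "(2::'f) \<noteq> 0" "m \<noteq> 0"
  shows "table 1 0 0 m 0 q s 0 \<simeq> table (1/2) 0 0 1 0 (q/2) (s/2) 0"
proof -
  obtain x where x: "x^2 = 1 / (2 * m)"
    using alg_closed_sqrt by blast
  then have "x \<noteq> 0"
    using assms by auto
  have "basis_change (table 1 0 0 m 0 q s 0) (table (1/2) 0 0 1 0 (q/2) (s/2) 0)
      (vector [1/2, 0]) (vector [0, x])"
    unfolding basis_change_table using assms x \<open>x \<noteq> 0\<close> by (simp add: field_simps power2_eq_square)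
  then show ?thesis
    by (rule isomorphic_tablesI)
qed

text \<open>The square of the second basis vector is completed; the algebra is then a product of two copies of
  the field (\<open>J1\<close>) or the algebra of dual numbers.\<close>

lemma unital_normal_form:
  fixes m n :: "'f::alg_closed_field"
  assumes "(2::'f) \<noteq> 0"
  shows "\<exists>B. table 1 0 0 m 0 1 1 n \<simeq> B \<and> normal_form B"
proof -
  define m' where "m' = m + (- n / 2) * (- n / 2)"
  have iso: "table 1 0 0 m 0 1 1 n \<simeq> table 1 0 0 m' 0 1 1 0"
    using shear_idempotent[of 0 0 m 1 1 n "- n / 2"] assms by (simp add: m'_def)
  show ?thesis
  proof (cases "m' = 0")
    case True
    then show ?thesis
      using iso normal_form_ideal by metis
  next
    case False
    have "table 1 0 0 m' 0 1 1 0 \<simeq> J1"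
      using rescale_idempotent[OF assms False] by (simp add: J1_def)
    then show ?thesis
      using algebra_isomorphic_trans[OF iso] by (auto simp: normal_form_def)
  qed
qed

lemma idempotent_normal_form:
  fixes p r m q s n :: "'f::alg_closed_field"
  assumes char: "(2::'f) \<noteq> 0" "(3::'f) \<noteq> 0" and J: "jordan_table (table 1 p r m 0 q s n)"
  shows "\<exists>B. table 1 p r m 0 q s n \<simeq> B \<and> normal_form B"
proof -
  obtain m' n' where iso: "table 1 p r m 0 q s n \<simeq> table 1 0 0 m' 0 q s n'"
    using idempotent_peirce[OF assms] by blast
  have J': "jordan_table (table 1 0 0 m' 0 q s n')"
    by (rule jordan_algebra_transfer[OF iso J])
  consider "m' = 0" "n' = 0" | "q = 1" "s = 1" | "q = -1" "s = 1" "n' = 0" "m' \<noteq> 0"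
    | "m' = 0" "q = 0" "s = 0" "n' \<noteq> 0"
    using peirce_eigenvalues[OF char J'] by (elim disjE) metis+
  then have "\<exists>B. table 1 0 0 m' 0 q s n' \<simeq> B \<and> normal_form B"
  proof cases
    case 1
    then show ?thesis
      using isomorphic_tables_refl normal_form_ideal by blast
  next
    case 2
    then show ?thesis
      using unital_normal_form[OF char(1)] by blast
  next
    case 3
    then have "table 1 0 0 m' 0 q s n' \<simeq> J2"
      using rescale_idempotent[OF char(1), of m' "-1" 1] by (simp add: J2_def)
    then show ?thesis
      by (auto simp: normal_form_def)
  next
    case 4
    \<comment> \<open>The product of two lines is unital: \<open>e + (1 / n') e2\<close> is the unit.\<close>
    have "table 1 0 0 m' 0 q s n' \<simeq> table 1 0 0 0 0 1 1 n'"
      using 4 by (intro isomorphic_tablesI[of _ _ 1 "1 / n'" 0 1], unfold basis_change_table) simp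
    then show ?thesis
      using unital_normal_form[OF char(1)] algebra_isomorphic_trans by blast
  qed
  then show ?thesis
    using algebra_isomorphic_trans[OF iso] by blast
qed

section \<open>Algebras with a square-zero vector\<close>

lemma cubic_root:
  fixes c0 c1 c2 c3 :: "'f::alg_closed_field"
  assumes "c1 \<noteq> 0 \<or> c2 \<noteq> 0 \<or> c3 \<noteq> 0"
  shows "\<exists>y. c0 + c1 * y + c2 * y^2 + c3 * y^3 = 0"
proof -
  have "degree [:c0, c1, c2, c3:] > 0"
    using assms by auto
  then obtain y where "poly [:c0, c1, c2, c3:] y = 0"
    using alg_closed_imp_poly_has_root by blast
  then show ?thesis
    by (intro exI[of _ y]) (simp add: algebra_simps power2_eq_square power3_eq_cube)
qed

text \<open>If \<open>e2\<^sup>2\<close> is not a multiple of \<open>e2\<close>, the vector \<open>u = e1 + y e2\<close> is parallel to its square when \<open>y\<close> is a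
  root of a cubic polynomial with leading coefficient \<open>A$1$4 \<noteq> 0\<close>.\<close>

lemma ex_eigenvector:
  fixes A :: "'f::alg_closed_field ^ 4 ^ 2"
  shows "\<exists>p q c. (p \<noteq> 0 \<or> q \<noteq> 0) \<and> coord_mul A (vector [p, q]) (vector [p, q]) = c *s vector [p, q]"
proof (cases "A$1$4 = 0")
  case True
  then show ?thesis
    by (intro exI[of _ 0] exI[of _ 1] exI[of _ "A$2$4"])
       (simp add: vec_eq_iff forall_2 coord_mul_nth)
next
  case False
  then obtain y where
    "- A$2$1 + (A$1$1 - A$2$2 - A$2$3) * y + (A$1$2 + A$1$3 - A$2$4) * y^2 + A$1$4 * y^3 = 0"
    using cubic_root[of "A$1$1 - A$2$2 - A$2$3" "A$1$2 + A$1$3 - A$2$4" "A$1$4" "- A$2$1"] by blast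
  then show ?thesis
    by (intro exI[of _ 1] exI[of _ y] exI[of _ "A$1$1 + (A$1$2 + A$1$3) * y + A$1$4 * y^2"])
       (simp add: vec_eq_iff forall_2 coord_mul_nth algebra_simps power2_eq_square power3_eq_cube)
qed

text \<open>Dividing the vector by \<open>c\<close> turns it into an idempotent.\<close>

lemma eigenvector_normal_form:
  fixes A :: "'f::alg_closed_field ^ 4 ^ 2"
  assumes char: "(2::'f) \<noteq> 0" "(3::'f) \<noteq> 0" and J: "jordan_table A"
    and eig: "coord_mul A (vector [p, q]) (vector [p, q]) = c *s vector [p, q]"
    and "p \<noteq> 0 \<or> q \<noteq> 0" "c \<noteq> 0"
  shows "\<exists>B. A \<simeq> B \<and> normal_form B"
proof -
  have "coord_mul A (vector [p / c, q / c]) (vector [p / c, q / c]) = 1 *s vector [p / c, q / c]"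
  proof -
    have "coord_mul A (vector [p / c, q / c]) (vector [p / c, q / c]) =
        (1 / c^2) *s coord_mul A (vector [p, q]) (vector [p, q])"
      by (simp add: vec_eq_iff coord_mul_nth algebra_simps power2_eq_square add_divide_distrib)
    then show ?thesis
      using \<open>c \<noteq> 0\<close> unfolding eig by (simp add: vec_eq_iff forall_2 power2_eq_square)
  qed
  moreover have "p / c \<noteq> 0 \<or> q / c \<noteq> 0"
    using assms by simp
  ultimately obtain a2 a3 a4 b2 b3 b4 where iso: "A \<simeq> table 1 a2 a3 a4 0 b2 b3 b4"
    using eigenvector_table by blast
  show ?thesis
    using idempotent_normal_form[OF char jordan_algebra_transfer[OF iso J]]
      algebra_isomorphic_trans[OF iso] by blast
qed

text \<open>The second basis vector \<open>n\<close> has square zero, so for \<open>u = y e1 + n\<close> the commutation relation has no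
  constant term in \<open>y\<close>. Its linear term says that \<open>L\<^sub>n\<close> commutes with \<open>R\<^sub>w\<close> for \<open>w = e1 n + n e1\<close>.\<close>

lemma square_zero_relations:
  fixes a p r b q s :: "'f::field"
  assumes char: "(2::'f) \<noteq> 0" "(3::'f) \<noteq> 0" and J: "jordan_table (table a p r 0 b q s 0)"
  shows "(p + r) * r = 0"
    and "s * ((p + r) * (a - s) + (q + s) * p) = ((p + r) * b + (q + s) * q) * r"
proof -
  note comm = jordan_commute_at[OF J, of _ 1]
  define P Q where "P = p + r" and "Q = q + s"
  have "- (P * r * r) + (p * (P * a + Q * p - P * s) - a * r * r - P * r * (a - q)) * y +
      (p * (a * a + b * p - a * s) - a * r * (a - q)) * y^2 = 0" if "y \<noteq> 0" for y
  proof -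
    have "y * (- (P * r * r) + (p * (P * a + Q * p - P * s) - a * r * r - P * r * (a - q)) * y +
      (p * (a * a + b * p - a * s) - a * r * (a - q)) * y^2) = 0"
      using comm(2)[of y] by (simp add: P_def Q_def algebra_simps power2_eq_square)
    then show ?thesis
      using that by simp
  qed
  from quadratic_zero(1)[OF char this] show "(p + r) * r = 0"
    by (auto simp: P_def)
  have "(s * (P * (a - s) + Q * p) - (P * b + Q * q) * r) +
      (b * (P * (a - s) + Q * p) + s * (a * (a - s) + b * p) - (P * b + Q * q) * (a - q)
         - (a * b + b * q) * r) * y +
      (b * (a * (a - s) + b * p) - (a * b + b * q) * (a - q)) * y^2 = 0" if "y \<noteq> 0" for y
  proof -
    have "y * ((s * (P * (a - s) + Q * p) - (P * b + Q * q) * r) +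
      (b * (P * (a - s) + Q * p) + s * (a * (a - s) + b * p) - (P * b + Q * q) * (a - q)
         - (a * b + b * q) * r) * y +
      (b * (a * (a - s) + b * p) - (a * b + b * q) * (a - q)) * y^2) = 0"
      using comm(3)[of y] by (simp add: P_def Q_def algebra_simps power2_eq_square)
    then show ?thesis
      using that by simp
  qed
  from quadratic_zero(1)[OF char this]
  show "s * ((p + r) * (a - s) + (q + s) * p) = ((p + r) * b + (q + s) * q) * r"
    by (simp add: P_def Q_def)
qed

text \<open>Both basis vectors have square zero. If \<open>q + s \<noteq> 0\<close>, a combination of them is a multiple of an
  idempotent. Otherwise \<open>q = s = 0\<close>, and the first basis vector spans the ideal.\<close>

lemma right_nil_normal_form:
  fixes p q s :: "'f::alg_closed_field"
  assumes char: "(2::'f) \<noteq> 0" "(3::'f) \<noteq> 0" and J: "jordan_table (table 0 p 0 0 0 q s 0)"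
    and "p \<noteq> 0"
  shows "\<exists>B. table 0 p 0 0 0 q s 0 \<simeq> B \<and> normal_form B"
proof (cases "q + s = 0")
  case False
  then show ?thesis
    using \<open>p \<noteq> 0\<close>
    by (intro eigenvector_normal_form[OF char J, of 1 "(q + s) / p" "q + s"])
       (simp_all add: vec_eq_iff forall_2 coord_mul_nth field_simps)
next
  case True
  have "s * (p * q) = 0"
    using square_zero_relations(2)[OF char J] by (simp add: algebra_simps)
  then have "q = 0" "s = 0"
    using True \<open>p \<noteq> 0\<close> by auto
  then have "table 0 p 0 0 0 q s 0 \<simeq> table 0 0 0 0 0 0 p 0"
    by (intro isomorphic_tablesI[of _ _ 0 1 1 0], unfold basis_change_table) simp
  then show ?thesis
    using normal_form_ideal by blast
qed

text \<open>The square-zero vector \<open>n\<close> anticommutes with \<open>e1\<close>, so adding a multiple of \<open>n\<close> to \<open>e1\<close> does not change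
  its square \<open>a e1 + b n\<close>. If \<open>a \<noteq> 0\<close>, then \<open>e1 + (b / a) n\<close> is a multiple of an idempotent. If \<open>a = 0\<close>, the
  Jordan identity gives \<open>b = 0\<close>, the algebra is anticommutative, and the product of the basis vectors
  spans the ideal.\<close>

lemma anticommuting_nil_normal_form:
  fixes a b p q :: "'f::alg_closed_field"
  assumes char: "(2::'f) \<noteq> 0" "(3::'f) \<noteq> 0"
    and J: "jordan_table (table a p (- p) 0 b q (- q) 0)" and "p \<noteq> 0"
  shows "\<exists>B. table a p (- p) 0 b q (- q) 0 \<simeq> B \<and> normal_form B"
proof (cases "a = 0")
  case False
  then show ?thesis
    by (intro eigenvector_normal_form[OF char J, of 1 "b / a" a])
       (simp_all add: vec_eq_iff forall_2 coord_mul_nth)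
next
  case True
  have "p * (b * p) = 0"
    using jordan_commute_at(2)[OF J, of 1 0] True
    by simp
  then have "b = 0"
    using \<open>p \<noteq> 0\<close> by simp
  with True \<open>p \<noteq> 0\<close> have "table a p (- p) 0 b q (- q) 0 \<simeq> table 0 0 0 0 0 (- p) p 0"
    by (intro isomorphic_tablesI[of _ _ 0 1 p q], unfold basis_change_table) simp
  then show ?thesis
    using normal_form_ideal by blast
qed

text \<open>By the first of the square-zero relations, either left multiplication by the square-zero vector \<open>n\<close> is
  nilpotent (\<open>r = 0\<close>), or \<open>r = - p\<close>. In the first case, unless \<open>n\<close> itself spans the ideal, \<open>e1\<close> can be
  moved to \<open>e1 + y n\<close> so that it is parallel to its square. In the second case \<open>n\<close> and \<open>e1\<close> anticommute.\<close>

lemma nil_normal_form: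
  fixes a p r b q s :: "'f::alg_closed_field"
  assumes char: "(2::'f) \<noteq> 0" "(3::'f) \<noteq> 0" and J: "jordan_table (table a p r 0 b q s 0)"
  shows "\<exists>B. table a p r 0 b q s 0 \<simeq> B \<and> normal_form B"
proof -
  note rel = square_zero_relations[OF char J]
  consider "r = 0" "p = 0" | "r = 0" "p \<noteq> 0" | "r \<noteq> 0"
    by blast
  then show ?thesis
  proof cases
    case 1
    then show ?thesis
      using isomorphic_tables_refl normal_form_ideal by blast
  next
    case 2
    obtain y where y: "b + (q + s - a) * y - p * y^2 = 0"
      using cubic_root[of "q + s - a" "- p" 0 b] \<open>p \<noteq> 0\<close> by auto
    show ?thesis
    proof (cases "a + y * p = 0")
      case False
      then show ?thesis
        using y \<open>r = 0\<close>
        by (intro eigenvector_normal_form[OF char J, of 1 y "a + y * p"])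
           (simp_all add: vec_eq_iff forall_2 coord_mul_nth algebra_simps power2_eq_square)
    next
      case True
      have "b + y * q + y * s = 0"
      proof -
        have "b + y * q + y * s = (b + (q + s - a) * y - p * y^2) + y * (a + y * p)"
          by (simp add: algebra_simps power2_eq_square)
        then show ?thesis
          using y True by simp
      qed
      with True have iso: "table a p r 0 b q s 0 \<simeq> table 0 p 0 0 0 (q - p * y) s 0"
        using \<open>r = 0\<close>
        by (intro isomorphic_tablesI[of _ _ 1 y 0 1], unfold basis_change_table)
           (simp add: algebra_simps)
      show ?thesis
        using right_nil_normal_form[OF char jordan_algebra_transfer[OF iso J] \<open>p \<noteq> 0\<close>]
          algebra_isomorphic_trans[OF iso] by blast
    qed
  next
    case 3
    then have r: "r = - p"
      using rel(1) by (simp add: eq_neg_iff_add_eq_0 add.commute)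
    then have "p \<noteq> 0"
      using 3 by simp
    have "p * ((q + s) * (q + s)) = 0"
      using rel(2) unfolding r by (simp add: algebra_simps)
    then have "s = - q"
      using \<open>p \<noteq> 0\<close> by (simp add: eq_neg_iff_add_eq_0 add.commute)
    then show ?thesis
      using anticommuting_nil_normal_form[OF char, of a p b q] J r \<open>p \<noteq> 0\<close> by simp
  qed
qed

text \<open>Depending on whether the multiple \<open>c\<close> in \<open>u\<^sup>2 = c u\<close> vanishes, one of the two preceding parts
  applies; in the square-zero case the two basis vectors are swapped to match the convention there.\<close>

theorem jordan_normal_form:
  fixes A :: "'f::alg_closed_field ^ 4 ^ 2"
  assumes char: "(2::'f) \<noteq> 0" "(3::'f) \<noteq> 0" and J: "jordan_table A"
  shows "\<exists>B. A \<simeq> B \<and> normal_form B"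
proof -
  obtain p q c where eig: "p \<noteq> 0 \<or> q \<noteq> 0"
    "coord_mul A (vector [p, q]) (vector [p, q]) = c *s vector [p, q]"
    using ex_eigenvector by blast
  show ?thesis
  proof (cases "c = 0")
    case True
    obtain a2 a3 a4 b2 b3 b4 where "A \<simeq> table 0 a2 a3 a4 0 b2 b3 b4"
      using eigenvector_table[OF eig(2,1)] True by blast
    moreover have "table 0 a2 a3 a4 0 b2 b3 b4 \<simeq> table b4 b3 b2 0 a4 a3 a2 0"
      by (rule isomorphic_tablesI[of _ _ 0 1 1 0], unfold basis_change_table) simp
    ultimately have iso: "A \<simeq> table b4 b3 b2 0 a4 a3 a2 0"
      by (rule algebra_isomorphic_trans)
    show ?thesis
      using nil_normal_form[OF char jordan_algebra_transfer[OF iso J]]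
        algebra_isomorphic_trans[OF iso] by blast
  qed (use eigenvector_normal_form[OF char J eig(2,1)] in blast)
qed

section \<open>Algebras with a square-zero ideal\<close>

lemma ideal_table_jordan:
  fixes a b c d :: "'f::field"
  assumes J: "jordan_table (ideal_table a b c d)"
  shows "d * (b * b - a * c) = 0" "(b * b - a * c) * (a - b - c) = 0"
proof -
  note J' = J[unfolded ideal_table_def]
  have "d * (a * (a - c)) = d * ((a + b) * (a - b))"
    using jordan_commute_at(3)[OF J', of 1 0]
    by (simp add: algebra_simps)
  then have 0: "d * (b * b - a * c) = 0"
    by (simp add: algebra_simps)
  have "(d + c) * (a * (a - c)) = (d * (a + b) + b * (b + c)) * (a - b)"
    using jordan_commute_at(3)[OF J', of 1 1]
    by (simp add: algebra_simps)
  then have "d * (b * b - a * c) = (b * b - a * c) * (a - b - c)"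
    by (simp add: algebra_simps)
  then show "(b * b - a * c) * (a - b - c) = 0"
    unfolding 0 by (rule sym)
  show "d * (b * b - a * c) = 0"
    by (rule 0)
qed

text \<open>For suitable \<open>t\<close> the shear that replaces \<open>e1\<close> by \<open>e1 + t e2\<close> removes \<open>d\<close> unless \<open>a = b + c\<close>.\<close>

lemma ideal_table_shear:
  "ideal_table a b c d \<simeq> ideal_table a b c (d + t * (b + c - a))"
  unfolding ideal_table_def
  by (rule isomorphic_tablesI[of _ _ 1 t 0 1], unfold basis_change_table) (simp add: algebra_simps)

lemma ideal_table_rescale:
  assumes "p \<noteq> 0" "s \<noteq> 0"
  shows "ideal_table a b c (s * d) \<simeq> ideal_table (p * a) (p * b) (p * c) (p * p * d)"
  unfolding ideal_table_def
  using assms by (intro isomorphic_tablesI[of _ _ p 0 0 s], unfold basis_change_table) (simp add: algebra_simps)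

lemma char_5_arithmetic:
  assumes "CHAR('f::field) = 5"
  shows "(5::'f) = 0" "(2::'f) \<noteq> 0" "(3::'f) \<noteq> 0"
  using of_nat_CHAR[where ?'a='f] of_nat_eq_0_iff_char_dvd[where ?'a='f, of 2]
    of_nat_eq_0_iff_char_dvd[where ?'a='f, of 3] assms by auto

text \<open>With \<open>d = 0\<close> the triple \<open>(a, b, c)\<close> matters only up to a nonzero factor. It is normalised to
  \<open>a + c = 1\<close> when possible. When \<open>a + c = 0\<close>, the line leaves \<open>b = 2 a\<close>, and the conic leaves
  \<open>b\<^sup>2 = - a\<^sup>2\<close>, hence \<open>b = \<plusminus> i a\<close>; the factors are those of the listed representatives.\<close>

lemma diagonal_in_jordan_list:
  fixes a b c :: "'f::field"
  assumes char: "(2::'f) \<noteq> 0" "(3::'f) \<noteq> 0" and i: "i^2 = -1" and rt: "\<And>x. (rt x)^2 = x"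
    and J: "b * b = a * c \<or> a = b + c" and nz: "a \<noteq> 0 \<or> b \<noteq> 0 \<or> c \<noteq> 0"
  shows "\<exists>B \<in> jordan_list rt i. ideal_table a b c 0 \<simeq> B"
proof -
  have scale: ?thesis if "p \<noteq> 0" "ideal_table (p * a) (p * b) (p * c) 0 \<in> jordan_list rt i" for p
    using ideal_table_rescale[of p 1 a b c 0] that by auto
  show ?thesis
  proof (cases "a + c = 0")
    case False
    define p where "p = 1 / (a + c)"
    have "p \<noteq> 0"
      using False by (simp add: p_def)
    have c: "p * c = - (p * a) + 1"
      using False by (simp add: p_def field_simps)
    from J show ?thesis
    proof
      assume "a = b + c"
      then have "p * b = -1 + 2 * (p * a)"
        using c by (simp add: algebra_simps)
      then have "ideal_table (p * a) (p * b) (p * c) 0 = J3 (p * a)"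
        by (simp add: ideal_table_def J3_def c)
      then show ?thesis
        using scale[OF \<open>p \<noteq> 0\<close>] by (auto simp: jordan_list_def)
    next
      assume "b * b = a * c"
      then have "(p * b)^2 = (p * a) * (p * c)"
        by (simp add: power2_eq_square algebra_simps)
      also have "\<dots> = (rt (p * a - (p * a)^2))^2"
        by (simp only: rt c) (simp add: algebra_simps power2_eq_square)
      finally have "p * b = rt (p * a - (p * a)^2) \<or> p * b = - rt (p * a - (p * a)^2)"
        by (simp add: power2_eq_iff)
      then consider "p * b = rt (p * a - (p * a)^2)" |
        "p * b = - rt (p * a - (p * a)^2)" "p * b \<noteq> rt (p * a - (p * a)^2)"
        by blast
      then show ?thesis
      proof cases
        case 1
        then have "ideal_table (p * a) (p * b) (p * c) 0 = J4 rt (p * a)"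
          by (simp add: ideal_table_def J4_def c)
        then show ?thesis
          using scale[OF \<open>p \<noteq> 0\<close>] by (auto simp: jordan_list_def)
      next
        case 2
        then have "ideal_table (p * a) (p * b) (p * c) 0 = J5 rt (p * a)"
          by (simp add: ideal_table_def J5_def c)
        \<comment> \<open>At these parameter values the square root vanishes, and \<open>J4\<close> has taken care of the point.\<close>
        moreover have "p * a \<notin> {0, 1}"
        proof
          assume "p * a \<in> {0, 1}"
          then have "rt (p * a - (p * a)^2) = 0"
            using rt[of 0] by auto
          then show False
            using 2 by simp
        qed
        ultimately show ?thesis
          using scale[OF \<open>p \<noteq> 0\<close>] by (auto simp: jordan_list_def)
      qed
    qed
  next
    case True
    then have c: "c = - a"
      by (simp add: eq_neg_iff_add_eq_0 add.commute)
    have "(b - i * a) * (b + i * a) = b * b - i^2 * (a * a)"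
      by (simp add: algebra_simps power2_eq_square)
    then have "(b - i * a) * (b + i * a) = b * b - a * c"
      by (simp add: i c)
    then have b: "b = 2 * a \<or> b = i * a \<or> b = - (i * a)"
      using J c by (auto simp: eq_neg_iff_add_eq_0)
    then have "a \<noteq> 0"
      using nz c by auto
    have "(1 - i) * (1 + i) = 2"
      using i by (simp add: algebra_simps power2_eq_square)
    then have i1: "1 - i \<noteq> 0" "1 + i \<noteq> 0"
      using char(1) by auto
    have i2: "i * i = - 1"
      using i by (simp add: power2_eq_square)
    from b show ?thesis
    proof (elim disjE)
      assume "b = 2 * a"
      then have "ideal_table (1 / (3 * a) * a) (1 / (3 * a) * b) (1 / (3 * a) * c) 0 = J6"
        using \<open>a \<noteq> 0\<close> char by (simp add: ideal_table_def J6_def c)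
      then show ?thesis
        using scale[of "1 / (3 * a)"] \<open>a \<noteq> 0\<close> char by (auto simp: jordan_list_def)
    next
      assume b: "b = i * a"
      have "(1 - i) / (2 * a) * b = 1/2 + i/2"
      proof -
        have "(1 - i) / (2 * a) * b = ((1 - i) * i) / 2"
          using \<open>a \<noteq> 0\<close> by (simp add: b)
        also have "((1 - i) * i) = 1 + i"
          by (simp add: algebra_simps i2)
        finally show ?thesis
          by (simp only: add_divide_distrib diff_divide_distrib)
      qed
      moreover have pa: "(1 - i) / (2 * a) * a = 1/2 - i/2"
        using \<open>a \<noteq> 0\<close> by (simp flip: diff_divide_distrib)
      moreover have "(1 - i) / (2 * a) * c = - (1/2) + i/2"
        unfolding c mult_minus_right pa by simp
      ultimately have "ideal_table ((1 - i) / (2 * a) * a) ((1 - i) / (2 * a) * b)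
          ((1 - i) / (2 * a) * c) 0 = J7 i"
        by (simp only: ideal_table_def J7_def)
      then show ?thesis
        using scale[of "(1 - i) / (2 * a)"] \<open>a \<noteq> 0\<close> char i1 by (auto simp: jordan_list_def)
    next
      assume b: "b = - (i * a)"
      have "(1 + i) / (2 * a) * b = 1/2 - i/2"
      proof -
        have "(1 + i) / (2 * a) * b = - ((1 + i) * i) / 2"
          using \<open>a \<noteq> 0\<close> by (simp add: b)
        also have "- ((1 + i) * i) = 1 - i"
          by (simp add: algebra_simps i2)
        finally show ?thesis
          by (simp only: add_divide_distrib diff_divide_distrib)
      qed
      moreover have pa: "(1 + i) / (2 * a) * a = 1/2 + i/2"
        using \<open>a \<noteq> 0\<close> by (simp flip: add_divide_distrib)
      moreover have "(1 + i) / (2 * a) * c = - (1/2) - i/2"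
        unfolding c mult_minus_right pa by simp
      ultimately have "ideal_table ((1 + i) / (2 * a) * a) ((1 + i) / (2 * a) * b)
          ((1 + i) / (2 * a) * c) 0 = J8 i"
        by (simp only: ideal_table_def J8_def)
      then show ?thesis
        using scale[of "(1 + i) / (2 * a)"] \<open>a \<noteq> 0\<close> char i1 by (auto simp: jordan_list_def)
    qed
  qed
qed

text \<open>This is where characteristic 5 enters: if \<open>a = b + c\<close> and \<open>d \<noteq> 0\<close>, the equation \<open>b\<^sup>2 = a c\<close> becomes a
  perfect square modulo 5, namely \<open>(b + 2 c)\<^sup>2 = 0\<close>. The value of \<open>d\<close> is then scaled to 1.\<close>

lemma ideal_table_in_jordan_list:
  fixes a b c d :: "'f::field"
  assumes char: "CHAR('f) = 5" and i: "i^2 = -1" and rt: "\<And>x. (rt x)^2 = x"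
    and J: "jordan_table (ideal_table a b c d)" and nz: "a \<noteq> 0 \<or> b \<noteq> 0 \<or> c \<noteq> 0 \<or> d \<noteq> 0"
  shows "\<exists>B \<in> jordan_list rt i. ideal_table a b c d \<simeq> B"
proof -
  note five = char_5_arithmetic(1)[OF char] and char' = char_5_arithmetic(2,3)[OF char]
  note rel = ideal_table_jordan[OF J]
  note diag = diagonal_in_jordan_list[where rt = rt, OF char' i rt]
  consider "a \<noteq> b + c" "d \<noteq> 0" | "d = 0" | "a = b + c" "d \<noteq> 0" "c = 0" | "a = b + c" "d \<noteq> 0" "c \<noteq> 0"
    by blast
  then show ?thesis
  proof cases
    case 1
    then have "b + c - a \<noteq> 0"
      by (simp add: algebra_simps)
    then have iso: "ideal_table a b c d \<simeq> ideal_table a b c 0"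
      using ideal_table_shear[of a b c d "- d / (b + c - a)"] by simp
    moreover have "b * b = a * c"
      using rel(1) 1 by simp
    moreover have "a \<noteq> 0 \<or> b \<noteq> 0 \<or> c \<noteq> 0"
      using 1 by auto
    ultimately show ?thesis
      using diag[of b a c] algebra_isomorphic_trans by blast
  next
    case 2
    have "b * b = a * c \<or> a = b + c"
      using rel(2) by (simp add: diff_diff_eq)
    then show ?thesis
      using diag[of b a c] 2 nz by simp
  next
    case 3
    then have "b = 0"
      using rel(1) by simp
    with 3 have "ideal_table a b c d = ideal_table 0 0 0 (d * 1)"
      by simp
    also have "\<dots> \<simeq> ideal_table 0 0 0 1"
      using ideal_table_rescale[of 1 d 0 0 0 1] 3 by simp
    also have "ideal_table 0 0 0 1 = (J10 :: 'f ^ 4 ^ 2)"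
      by (simp add: ideal_table_def J10_def)
    finally show ?thesis
      by (auto simp: jordan_list_def)
  next
    case 4
    have "(b + 2 * c) * (b + 2 * c) = (b * b - (b + c) * c) + 5 * (c * (b + c))"
      by (simp add: algebra_simps)
    then have b: "b = - 2 * c"
      using rel(1) 4 five by (simp add: eq_neg_iff_add_eq_0)
    then have a: "a = - c"
      using 4 by simp
    define p where "p = - 1 / (3 * c)"
    have "p \<noteq> 0"
      using 4 char' by (simp add: p_def)
    have "ideal_table a b c d \<simeq> ideal_table (p * a) (p * b) (p * c) 1"
      using ideal_table_rescale[of p "p * p * d" a b c "1 / (p * p)"] 4 \<open>p \<noteq> 0\<close> by simp
    moreover have "p * a = 1/3" "p * b = 2/3" "p * c = - (1/3)"
      using 4(3) char' by (simp_all add: p_def a b)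
    ultimately have "ideal_table a b c d \<simeq> J9"
      by (simp add: ideal_table_def J9_def)
    then show ?thesis
      by (auto simp: jordan_list_def)
  qed
qed

section \<open>Uniqueness\<close>

text \<open>The three alternatives are met by \<open>J3\<close> to \<open>J5\<close>, by \<open>J6\<close> to \<open>J9\<close>, and by \<open>J10\<close>.\<close>

definition normalized :: "'f::field \<Rightarrow> 'f \<Rightarrow> 'f \<Rightarrow> 'f \<Rightarrow> bool" where
  "normalized a b c d \<longleftrightarrow>
     (a + c = 1 \<or> a + c = 0 \<and> a + b = 1 \<or> a = 0 \<and> b = 0 \<and> c = 0 \<and> d \<noteq> 0) \<and>
     (d = 0 \<or> d = 1 \<and> a = b + c)"

lemma jordan_list_cases:
  fixes A :: "'f::field ^ 4 ^ 2"
  assumes char: "(2::'f) \<noteq> 0" "(3::'f) \<noteq> 0" and "A \<in> jordan_list rt i"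
  obtains "A = J1" | "A = J2" | a b c d where "A = ideal_table a b c d" "normalized a b c d"
proof -
  have third: "1/3 + 2/3 = (1::'f)" and half: "1/2 + 1/2 = (1::'f)"
    using char by (simp_all flip: add_divide_distrib)
  have thirds: "1/3 = (2/3 + - (1/3) :: 'f)"
    by (simp flip: diff_divide_distrib)
  have sum: "1/2 - i/2 + (1/2 + i/2) = 1" "1/2 + i/2 + (1/2 - i/2) = 1"
    using half by (simp_all add: algebra_simps)
  have "A = J1 \<or> A = J2 \<or> (\<exists>a b c d. A = ideal_table a b c d \<and> normalized a b c d)"
    using assms(3) unfolding jordan_list_def
  proof (elim UnE insertE emptyE rangeE imageE)
    assume "A = J6"
    then have "A = ideal_table (1/3) (2/3) (- (1/3)) 0 \<and> normalized (1/3) (2/3) (- (1/3) :: 'f) 0"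
      using third by (simp add: J6_def ideal_table_def normalized_def)
    then show ?thesis by blast
  next
    assume "A = J7 i"
    then have "A = ideal_table (1/2 - i/2) (1/2 + i/2) (- (1/2) + i/2) 0 \<and>
        normalized (1/2 - i/2) (1/2 + i/2) (- (1/2) + i/2) 0"
      using sum by (simp add: J7_def ideal_table_def normalized_def)
    then show ?thesis by blast
  next
    assume "A = J8 i"
    then have "A = ideal_table (1/2 + i/2) (1/2 - i/2) (- (1/2) - i/2) 0 \<and>
        normalized (1/2 + i/2) (1/2 - i/2) (- (1/2) - i/2) 0"
      using sum by (simp add: J8_def ideal_table_def normalized_def)
    then show ?thesis by blast
  next
    assume "A = J9"
    then have "A = ideal_table (1/3) (2/3) (- (1/3)) 1 \<and> normalized (1/3) (2/3) (- (1/3) :: 'f) 1"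
      using third thirds by (simp add: J9_def ideal_table_def normalized_def)
    then show ?thesis by blast
  next
    assume "A = J10"
    then have "A = ideal_table 0 0 0 1 \<and> normalized 0 0 0 (1::'f)"
      by (simp add: J10_def ideal_table_def normalized_def)
    then show ?thesis by blast
  next
    fix x assume "A = J3 x"
    then have "A = ideal_table x (-1 + 2 * x) (- x + 1) 0 \<and> normalized x (-1 + 2 * x) (- x + 1) 0"
      by (simp add: J3_def ideal_table_def normalized_def)
    then show ?thesis by blast
  next
    fix x assume "A = J4 rt x"
    then have "A = ideal_table x (rt (x - x^2)) (- x + 1) 0 \<and> normalized x (rt (x - x^2)) (- x + 1) 0"
      by (simp add: J4_def ideal_table_def normalized_def)
    then show ?thesis by blast
  next
    fix x assume "A = J5 rt x"
    then have "A = ideal_table x (- rt (x - x^2)) (- x + 1) 0 \<and> normalized x (- rt (x - x^2)) (- x + 1) 0"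
      by (simp add: J5_def ideal_table_def normalized_def)
    then show ?thesis by blast
  qed auto
  then show ?thesis
    using that by blast
qed

text \<open>The matrix of the isomorphism has rows \<open>(p, q)\<close> and \<open>(r, s)\<close>. A nonzero \<open>r\<close> would force \<open>a = 0\<close>, since
  the image of \<open>e2\<close> has square zero, and then \<open>b = c = 0\<close> and \<open>d = 0\<close>. So \<open>r = 0\<close>, and comparing
  structure constants becomes immediate.\<close>

lemma ideal_table_iso_triangular:
  fixes a b c d :: "'f::field"
  assumes iso: "ideal_table a b c d \<simeq> ideal_table a' b' c' d'"
    and nz: "a \<noteq> 0 \<or> b \<noteq> 0 \<or> c \<noteq> 0 \<or> d \<noteq> 0"
  shows "\<exists>p q s. p \<noteq> 0 \<and> s \<noteq> 0 \<and> a' = p * a \<and> b' = p * b \<and> c' = p * c \<and>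
    p * p * d + p * q * (b + c - a) = d' * s"
proof -
  obtain p q r s where "basis_change (ideal_table a b c d) (ideal_table a' b' c' d')
      (vector [p, q]) (vector [r, s])"
    using isomorphic_tablesE[OF iso] by blast
  then have det: "p * s - q * r \<noteq> 0"
    and f11: "a * (p * p) = a' * p + d' * r"
      "d * (p * p) + b * (p * q) + c * (q * p) = a' * q + d' * s"
    and f12: "a * (p * r) = b' * r" "d * (p * r) + b * (p * s) + c * (q * r) = b' * s"
    and f21: "a * (r * p) = c' * r" "d * (r * p) + b * (r * q) + c * (s * p) = c' * s"
    and f22: "a * (r * r) = 0" "d * (r * r) + b * (r * s) + c * (s * r) = 0"
    unfolding ideal_table_def basis_change_table by simp_all
  have "r = 0"
  proof (rule ccontr)
    assume "r \<noteq> 0"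
    then have a: "a = 0"
      using f22(1) by simp
    have "r * (d * r + b * s + c * s) = 0"
      using f22(2) by (simp add: algebra_simps)
    then have 1: "d * r + b * s + c * s = 0"
      using \<open>r \<noteq> 0\<close> by simp
    then have "b' = 0" "c' = 0"
      using f12(1) f21(1) \<open>r \<noteq> 0\<close> unfolding a by simp_all
    then have 2: "d * (p * r) + b * (p * s) + c * (q * r) = 0"
      and 3: "d * (r * p) + b * (r * q) + c * (s * p) = 0"
      using f12(2) f21(2) by simp_all
    have "(p * s - q * r) * c = p * (d * r + b * s + c * s) - (d * (p * r) + b * (p * s) + c * (q * r))"
      "(p * s - q * r) * b = p * (d * r + b * s + c * s) - (d * (r * p) + b * (r * q) + c * (s * p))"
      by (simp_all add: algebra_simps)
    then have "b = 0" "c = 0"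
      using det unfolding 1 2 3 by simp_all
    then show False
      using 1 a nz \<open>r \<noteq> 0\<close> by simp
  qed
  then have ps: "p \<noteq> 0" "s \<noteq> 0"
    using det by auto
  then have "a' = p * a" "b' = p * b" "c' = p * c"
    using f11(1) f12(2) f21(2) \<open>r = 0\<close> by (simp_all add: algebra_simps)
  moreover have "p * p * d + p * q * (b + c - a) = d' * s"
    using f11(2) \<open>a' = p * a\<close> by (simp add: algebra_simps)
  ultimately show ?thesis
    using ps by blast
qed

text \<open>The normalisation fixes the scaling factor of \<open>(a, b, c)\<close>: a sum that vanishes for one triple vanishes
  for the other, and one that equals 1 must be multiplied by 1. When \<open>d\<close> can be nonzero, \<open>a = b + c\<close>, so
  that shears leave \<open>d\<close> unchanged and only its vanishing is invariant.\<close>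

lemma normalized_unique:
  assumes iso: "ideal_table a b c d \<simeq> ideal_table a' b' c' d'"
    and norm: "normalized a b c d" "normalized a' b' c' d'"
  shows "ideal_table a b c d = ideal_table a' b' c' d'"
proof -
  have "a \<noteq> 0 \<or> b \<noteq> 0 \<or> c \<noteq> 0 \<or> d \<noteq> 0"
    using norm(1) by (auto simp: normalized_def)
  then obtain p q s where ps: "p \<noteq> 0" "s \<noteq> 0" and abc: "a' = p * a" "b' = p * b" "c' = p * c"
    and d: "p * p * d + p * q * (b + c - a) = d' * s"
    using ideal_table_iso_triangular[OF iso] by blast
  have sums: "a' + c' = p * (a + c)" "a' + b' = p * (a + b)"
    by (simp_all add: abc algebra_simps)
  have eq: "a = a'" "b = b'" "c = c'"
  proof -
    have "p = 1 \<or> a = 0 \<and> b = 0 \<and> c = 0"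
    proof (cases "a = 0 \<and> b = 0 \<and> c = 0")
      case False
      then have "\<not> (a' = 0 \<and> b' = 0 \<and> c' = 0)"
        using ps by (auto simp: abc)
      with False norm have "a + c = 1 \<or> a + c = 0 \<and> a + b = 1" "a' + c' = 1 \<or> a' + c' = 0 \<and> a' + b' = 1"
        by (auto simp: normalized_def)
      then show ?thesis
        unfolding sums using ps by auto
    qed simp
    then show "a = a'" "b = b'" "c = c'"
      by (auto simp: abc)
  qed
  have "d = d'"
  proof (cases "a = b + c")
    case True
    then have "p * p * d = d' * s"
      using d by simp
    then have "d = 0 \<longleftrightarrow> d' = 0"
      using ps by auto
    then show ?thesis
      using norm by (auto simp: normalized_def)
  next
    case False
    then show ?thesis
      using norm eq by (auto simp: normalized_def)
  qed
  then show ?thesis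
    using eq by simp
qed

text \<open>\<open>J1\<close> is commutative. In \<open>J2\<close> the two products of the basis vectors differ in sign, so the second
  basis vector would be zero.\<close>

lemma J1_not_J2:
  assumes "(2::'f::field) \<noteq> 0"
  shows "\<not> (J1 :: 'f ^ 4 ^ 2) \<simeq> J2"
proof
  assume "(J1 :: 'f ^ 4 ^ 2) \<simeq> J2"
  then obtain p q r s :: 'f where chg: "basis_change J1 J2 (vector [p, q]) (vector [r, s])"
    by (rule isomorphic_tablesE)
  define h :: 'f where "h = 1/2"
  have h: "h + h = 1"
    using assms by (simp add: h_def flip: add_divide_distrib)
  have J: "J1 = table h 0 0 1 0 h h 0" "J2 = table h 0 0 1 0 (- h) h 0"
    by (simp_all add: J1_def J2_def h_def)
  have det: "p * s - q * r \<noteq> 0"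
    and prod: "h * (p * r) + q * s = - h * r" "h * (r * p) + s * q = h * r"
      "h * (p * s) + h * (q * r) = - h * s" "h * (r * q) + h * (s * p) = h * s"
    using chg unfolding J basis_change_table by simp_all
  have "h * r = - h * r"
    using prod(1,2) by (simp add: mult.commute)
  moreover have "h * s = - h * s"
    using prod(3,4) by (simp add: mult.commute add.commute)
  ultimately have "(h + h) * r = 0" "(h + h) * s = 0"
    by (simp_all add: distrib_right eq_neg_iff_add_eq_0)
  then show False
    unfolding h using det by simp
qed

text \<open>In \<open>J1\<close> no nonzero vector has square zero. In \<open>J2\<close> a nonzero vector \<open>(r, s)\<close> of square zero has
  \<open>r \<noteq> 0\<close>; if its line were an ideal, left and right multiplication would act on it by the same
  factor, which contradicts linear independence.\<close>

lemma J1_J2_not_ideal_table: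
  assumes two: "(2::'f::field) \<noteq> 0" and A: "A = J1 \<or> A = (J2 :: 'f ^ 4 ^ 2)"
  shows "\<not> A \<simeq> ideal_table a b c d"
proof
  assume "A \<simeq> ideal_table a b c d"
  then obtain p q r s where chg: "basis_change A (ideal_table a b c d) (vector [p, q]) (vector [r, s])"
    by (rule isomorphic_tablesE)
  define h :: 'f where "h = 1/2"
  have h: "h + h = 1"
    using two by (simp add: h_def flip: add_divide_distrib)
  then have "h \<noteq> 0"
    by auto
  obtain e where A_eq: "A = table h 0 0 1 0 e h 0" and e: "e = h \<or> e = - h"
    using A by (auto simp: J1_def J2_def h_def)
  have det: "p * s - q * r \<noteq> 0"
    and sq: "h * (r * r) + s * s = 0" "e * (r * s) + h * (s * r) = 0"
    and prod: "h * (p * r) + q * s = b * r" "e * (p * s) + h * (q * r) = b * s"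
      "h * (r * p) + s * q = c * r" "e * (r * q) + h * (s * p) = c * s"
    using chg unfolding A_eq ideal_table_def basis_change_table by simp_all
  show False
    using e
  proof
    assume "e = h"
    then have "(h + h) * (r * s) = 0"
      using sq(2) by (simp only: distrib_right mult.commute[of s r])
    then have "r * s = 0"
      unfolding h by simp
    then show False
      using sq(1) \<open>h \<noteq> 0\<close> det by auto
  next
    assume e: "e = - h"
    have "r \<noteq> 0"
      using sq(1) det by auto
    moreover have "b * r = c * r"
      using prod(1,3) by (simp only: mult.commute)
    ultimately have "b = c"
      by simp
    then have "e * (p * s) + h * (q * r) = e * (r * q) + h * (s * p)"
      using prod(2,4) by simp
    moreover have "(h + h) * (p * s - q * r) =
        (e * (r * q) + h * (s * p)) - (e * (p * s) + h * (q * r))"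
      by (simp add: e algebra_simps)
    ultimately show False
      unfolding h using det by simp
  qed
qed

section \<open>The classification\<close>

theorem theorem3p4:
  fixes sc :: "'f::alg_closed_field \<Rightarrow> 'v::ab_group_add \<Rightarrow> 'v"
    and mul :: "'v \<Rightarrow> 'v \<Rightarrow> 'v"
    and i :: 'f
    and rt :: "'f \<Rightarrow> 'f"
  assumes "CHAR('f) = 5"
    and "i^2 = -1"
    and "\<And>a. (rt a)^2 = a"
    and "jordan_algebra sc mul"
    and "vector_space.dim sc (UNIV :: 'v set) = 2"
    and "nontrivial_mul mul"
  shows "(\<exists>!A. A \<in> jordan_list rt i \<and> algebra_isomorphic sc mul (*s) (coord_mul A)) \<and>
         (J9 :: 'f ^ 4 ^ 2) = vector [vector [-(1/2), 0, 0, 0], vector [1, -1, 1/2, 0]]"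
proof (intro conjI ex_ex1I)
  note char = char_5_arithmetic(2,3)[OF assms(1)]
  interpret jordan_algebra sc mul by fact
  interpret R: Vector_Spaces.linear sc sc "\<lambda>v. mul u v" for u by (rule linear_right)
  obtain A where iso: "algebra_isomorphic sc mul (*s) (coord_mul A)"
    using exists_coordinates[OF nonassoc_algebra_axioms assms(5)] by blast
  obtain B where "A \<simeq> B" and nf: "normal_form B"
    using jordan_normal_form[OF char jordan_algebra_transfer[OF iso assms(4)]] by blast
  then have isoB: "algebra_isomorphic sc mul (*s) (coord_mul B)"
    using algebra_isomorphic_trans[OF iso] by blast
  have "\<exists>C \<in> jordan_list rt i. B \<simeq> C"
  proof (cases "B = J1 \<or> B = J2")
    case True
    then show ?thesis
      using isomorphic_tables_refl[of B] by (auto simp: jordan_list_def)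
  next
    case False
    then obtain a b c d where B: "B = ideal_table a b c d"
      using nf by (auto simp: normal_form_def)
    have "a \<noteq> 0 \<or> b \<noteq> 0 \<or> c \<noteq> 0 \<or> d \<noteq> 0"
    proof (rule ccontr)
      assume "\<not> ?thesis"
      then have zero: "coord_mul B u v = 0" for u v
        by (simp add: B ideal_table_def vec_eq_iff forall_2 coord_mul_nth)
      obtain f where f: "bij f" "\<And>u v. f (mul u v) = coord_mul B (f u) (f v)"
        using isoB by (auto simp: algebra_isomorphic_def)
      obtain u v where "mul u v \<noteq> 0"
        using assms(6) by (auto simp: nontrivial_mul_def)
      moreover have "mul u v = mul u 0"
        using f zero by (metis bij_is_inj injD)
      ultimately show False
        using R.zero by simp
    qed
    then show ?thesis
      using ideal_table_in_jordan_list[OF assms(1,2,3), of a b c d]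
        jordan_algebra_transfer[OF isoB assms(4)] unfolding B by blast
  qed
  then show "\<exists>A. A \<in> jordan_list rt i \<and> algebra_isomorphic sc mul (*s) (coord_mul A)"
    using algebra_isomorphic_trans[OF isoB] by blast
next
  note char = char_5_arithmetic(2,3)[OF assms(1)]
  fix A B
  assume A: "A \<in> jordan_list rt i \<and> algebra_isomorphic sc mul (*s) (coord_mul A)"
    and B: "B \<in> jordan_list rt i \<and> algebra_isomorphic sc mul (*s) (coord_mul B)"
  then have iso: "A \<simeq> B" and iso': "B \<simeq> A"
    using algebra_isomorphic_sym algebra_isomorphic_trans by blast+
  note not = J1_not_J2[OF char(1)] J1_J2_not_ideal_table[OF char(1)]
  from A have A: "A \<in> jordan_list rt i" by blast
  from B have B: "B \<in> jordan_list rt i" by blast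
  show "A = B"
  proof (rule jordan_list_cases[OF char A])
    assume "A = J1"
    then show ?thesis
      using jordan_list_cases[OF char B] iso not by metis
  next
    assume "A = J2"
    then show ?thesis
      using jordan_list_cases[OF char B] iso iso' not by metis
  next
    fix a b c d assume A: "A = ideal_table a b c d" "normalized a b c d"
    show ?thesis
    proof (rule jordan_list_cases[OF char B])
      fix a' b' c' d' assume "B = ideal_table a' b' c' d'" "normalized a' b' c' d'"
      then show ?thesis
        using normalized_unique iso A by blast
    qed (use A iso' not in blast)+
  qed
next
  note five = char_5_arithmetic(1)[OF assms(1)] and char = char_5_arithmetic(2,3)[OF assms(1)]
  \<comment> \<open>Modulo 5 the denominators 3 and \<open>- 2\<close> agree.\<close>
  have "(3::'f) + 2 = 0"
    using five by simp
  then have three: "(3::'f) = - 2"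
    by (simp only: eq_neg_iff_add_eq_0)
  show "(J9 :: 'f ^ 4 ^ 2) = vector [vector [-(1/2), 0, 0, 0], vector [1, -1, 1/2, 0]]"
    unfolding J9_def three using char(1) by simp
qed

end
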